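(* Fix a truth-value structure $\mathbf{B}$ (three-valued or two-valued). Let $\Gamma$ be a context, $T$ a table, $c$ a condition, $\sigma_1,\sigma_2,\tau,\tau'$ schemas, $\vec{t{:}x}$ and $\vec{u{:}y}$ select lists, and let $S,S'$ be evaluations such that $$[\![\Gamma\vdash \mathtt{SELECT}~\vec{t{:}x}~\mathtt{FROM}~\mathit{query}\,(\mathtt{SELECT}~\vec{u{:}y}~\mathtt{FROM}~T{:}\sigma_2~\mathtt{WHERE}~c){:}\sigma_1~\mathtt{WHERE}~\mathtt{TRUE} : \tau]\!]^{\mathbf{B}}\Downarrow S,$$ $$[\![\Gamma\vdash \mathtt{SELECT}~(\vec{t{:}x})[0.\sigma_1 := \vec u]~\mathtt{FROM}~T{:}\sigma_2~\mathtt{WHERE}~c : \tau']\!]^{\mathbf{B}}\Downarrow S'.$$ Then for every environment $\eta$ for $\Gamma$, $S\,\eta$ and $S'\,\eta$ are (heterogeneously) equal, i.e. they are the same multiset of tuples.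
   Context: If $\sigma_1=x_1,\dots,x_k$ and $\vec u=u_1,\dots,u_k$, the substitution $(\vec{t{:}x})[0.\sigma_1:=\vec u]$ replaces, in each term of the select list (names unchanged), the term $0.x_i$ by $u_i$ ($i=1,\dots,k$) and leaves other terms unchanged. Terms are $n.x$ (de Bruijn index $n$ into the context, name $x$), constants, or NULL. The semantics is as follows. Values are constants or NULL. A schema is a finite list of names; a context is a finite list of schemas. Tables are $\mathit{table}~x$ (a stored table of a database, which assigns to some names $x$ a schema $D(x)$ and a finite multiset $D_{rel}(x)$ of $|D(x)|$-tuples) or $\mathit{query}~Q$. Relations are finite multisets of tuples, with $\times$ (product), $\sigma_p$ (filter), $\sum_{v\leftarrow r} f(v)$ (comprehension: $\#(\cdot,w)=\sum_{v:f(v)=w}\#(r,v)$), $\|\cdot\|$ (deduplication). An environment for $\Gamma=\sigma_1,\dots,\sigma_k$ is a list of value lists of lengths $|\sigma_i|$; $[\Gamma'\mapsto v]$ splits a tuple $v$ into an environment for $\Gamma'$, and $\mathbin{++}$ concatenates environments. Term semantics: $n.x$ in context $\Gamma$ evaluates (only if $x$ occurs exactly once in $\Gamma(n)$) to the entry of the $n$-th list of the environment at the position of $x$ in $\Gamma(n)$; constants/NULL evaluate to themselves. Tables: $\mathit{table}~x$ evaluates to $D_{rel}(x)$ with schema $D(x)$; $\mathit{query}~Q$ to the evaluation of $Q$. A FROM list $T_1{:}\rho_1,\dots,T_l{:}\rho_l$ in $\Gamma$ evaluates, when each $T_i$ evaluates with a schema of length $|\rho_i|$, to the context $\Gamma'=\rho_1,\dots,\rho_l$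 and $\eta\mapsto$ the product of the $T_i$'s evaluations. A query $\mathtt{SELECT}~\vec{t{:}x}~\mathtt{FROM}~\vec{T{:}\rho}~\mathtt{WHERE}~c$ in $\Gamma$ has schema $\vec x$ and evaluates (when the FROM list evaluates to $\Gamma',S_F$ and $c$, $\vec t$ evaluate to $S_c,S_t$ in context $\Gamma',\Gamma$) to $\eta\mapsto\sum_{v\leftarrow\sigma_p(S_F\eta)} S_t([\Gamma'\mapsto v]\mathbin{++}\eta)$, with $p(v)$ true iff $S_c([\Gamma'\mapsto v]\mathbin{++}\eta)$ is the truth value btrue. The condition $\mathtt{TRUE}$ evaluates to btrue; conditions in general evaluate to functions from environments to $\mathbf{B}$, where $\mathbf{B}$ is either Kleene three-valued logic or Boolean logic (semantics of general conditions as standard for SQL with nulls: comparisons involving NULL yield the unknown value, which is identified with false in the Boolean case). *)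

theory Defs
  imports "HOL-Library.Multiset"
begin

record 'b truth_structure =
  btrue :: 'b
  bfalse :: 'b
  bunknown :: 'b
  band :: "'b \<Rightarrow> 'b \<Rightarrow> 'b"
  bor :: "'b \<Rightarrow> 'b \<Rightarrow> 'b"
  bneg :: "'b \<Rightarrow> 'b"

text \<open>The laws below determine the tables of conjunction and disjunction completely,
  both on two and on three truth values.\<close>

definition connective_laws :: "('b, 'z) truth_structure_scheme \<Rightarrow> bool" where
  "connective_laws B \<longleftrightarrow>
     (\<forall>a. band B (btrue B) a = a \<and> band B a (btrue B) = a \<and>
          band B (bfalse B) a = bfalse B \<and> band B a (bfalse B) = bfalse B \<and>
          band B a a = a) \<and>
     (\<forall>a. bor B (bfalse B) a = a \<and> bor B a (bfalse B) = a \<and>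
          bor B (btrue B) a = btrue B \<and> bor B a (btrue B) = btrue B \<and>
          bor B a a = a) \<and>
     bneg B (btrue B) = bfalse B \<and> bneg B (bfalse B) = btrue B"

definition kleene_logic :: "('b, 'z) truth_structure_scheme \<Rightarrow> bool" where
  "kleene_logic B \<longleftrightarrow>
     UNIV = {btrue B, bfalse B, bunknown B} \<and>
     distinct [btrue B, bfalse B, bunknown B] \<and>
     connective_laws B \<and> bneg B (bunknown B) = bunknown B"

definition boolean_logic :: "('b, 'z) truth_structure_scheme \<Rightarrow> bool" where
  "boolean_logic B \<longleftrightarrow>
     UNIV = {btrue B, bfalse B} \<and> btrue B \<noteq> bfalse B \<and>
     bunknown B = bfalse B \<and> connective_laws B"

definition of_bool_in :: "('b, 'z) truth_structure_scheme \<Rightarrow> bool \<Rightarrow> 'b" where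
  "of_bool_in B p = (if p then btrue B else bfalse B)"

text \<open>\<open>'n\<close> is the type of names, \<open>'k\<close> the type of constants. \<open>Attr n x\<close> is \<open>n.x\<close>.\<close>

type_synonym 'n schema = "'n list"
type_synonym 'n ctxt = "'n schema list"

datatype 'k val = VConst 'k | VNull

datatype ('n, 'k) tm = Attr nat 'n | Const 'k | NULL

datatype quantifier = QAll | QDistinct

text \<open>An atomic predicate is given directly by its interpretation on constants; its arity is
  the number of terms it is applied to. \<open>t IS NOT NULL\<close> and \<open>ts NOT IN Q\<close> are rendered as
  \<open>CNot (CIsNull t)\<close> and \<open>CNot (CIn ts Q)\<close>.\<close>

datatype ('n, 'k) cond =
    CTrue
  | CFalse
  | CIsNull "('n, 'k) tm"
  | CPred "'k list \<Rightarrow> bool" "('n, 'k) tm list"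
  | CIn "('n, 'k) tm list" "('n, 'k) query"
  | CExists "('n, 'k) query"
  | CAnd "('n, 'k) cond" "('n, 'k) cond"
  | COr "('n, 'k) cond" "('n, 'k) cond"
  | CNot "('n, 'k) cond"
and ('n, 'k) query =
    Select quantifier "(('n, 'k) tm \<times> 'n) list" "(('n, 'k) table \<times> 'n schema) list" "('n, 'k) cond"
  | is_star: SelectStar quantifier "(('n, 'k) table \<times> 'n schema) list" "('n, 'k) cond"
  | QUnion quantifier "('n, 'k) query" "('n, 'k) query"
  | QIntersect quantifier "('n, 'k) query" "('n, 'k) query"
  | QExcept quantifier "('n, 'k) query" "('n, 'k) query"
and ('n, 'k) table =
    Table 'n
  | Query "('n, 'k) query"

type_synonym ('n, 'k) select_list = "(('n, 'k) tm \<times> 'n) list"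
type_synonym ('n, 'k) from_list = "(('n, 'k) table \<times> 'n schema) list"

text \<open>The term replaced is \<open>0.x\<close> with \<open>x\<close> in the given schema. If a name is repeated in the
  schema, the first occurrence counts; such an \<open>0.x\<close> has no evaluation anyway.\<close>

fun subst_tm :: "'n schema \<Rightarrow> ('n, 'k) tm list \<Rightarrow> ('n, 'k) tm \<Rightarrow> ('n, 'k) tm" where
  "subst_tm \<sigma> us (Attr 0 x) =
     (case map_of (zip \<sigma> us) x of Some u \<Rightarrow> u | None \<Rightarrow> Attr 0 x)"
| "subst_tm \<sigma> us t = t"

definition subst_select ::
  "('n, 'k) select_list \<Rightarrow> 'n schema \<Rightarrow> ('n, 'k) tm list \<Rightarrow> ('n, 'k) select_list" where
  "subst_select txs \<sigma> us = map (\<lambda>(t, x). (subst_tm \<sigma> us t, x)) txs"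

type_synonym 'k rel = "'k val list multiset"
type_synonym 'k env = "'k val list list"

definition rel_times :: "'k rel \<Rightarrow> 'k rel \<Rightarrow> 'k rel" where
  "rel_times r s = (\<Sum>v\<in>#r. image_mset (\<lambda>w. v @ w) s)"

definition rel_dedup :: "'k rel \<Rightarrow> 'k rel" where
  "rel_dedup r = mset_set (set_mset r)"

definition quantify :: "quantifier \<Rightarrow> 'k rel \<Rightarrow> 'k rel" where
  "quantify d r = (case d of QAll \<Rightarrow> r | QDistinct \<Rightarrow> rel_dedup r)"

text \<open>For \<open>EXCEPT\<close> without \<open>ALL\<close> a tuple survives iff it does not occur in the second operand
  at all.\<close>

definition rel_except :: "quantifier \<Rightarrow> 'k rel \<Rightarrow> 'k rel \<Rightarrow> 'k rel" where
  "rel_except d r s = (case d of QAll \<Rightarrow> r - s | QDistinct \<Rightarrow> rel_dedup r - s)"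

record ('n, 'k) database =
  db_schema :: "'n \<Rightarrow> 'n schema option"
  db_rel :: "'n \<Rightarrow> 'k rel"

definition wf_database :: "('n, 'k) database \<Rightarrow> bool" where
  "wf_database D \<longleftrightarrow>
     (\<forall>x \<sigma>. db_schema D x = Some \<sigma> \<longrightarrow> (\<forall>v \<in># db_rel D x. length v = length \<sigma>))"

definition env_for :: "'n ctxt \<Rightarrow> 'k env \<Rightarrow> bool" where
  "env_for \<Gamma> \<eta> \<longleftrightarrow> list_all2 (\<lambda>\<sigma> vs. length vs = length \<sigma>) \<Gamma> \<eta>"

text \<open>\<open>split_env \<Gamma>' v\<close> is \<open>[\<Gamma>' \<mapsto> v]\<close>.\<close>

fun split_env :: "'n ctxt \<Rightarrow> 'k val list \<Rightarrow> 'k env" where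
  "split_env [] v = []"
| "split_env (\<sigma> # \<Gamma>) v = take (length \<sigma>) v # split_env \<Gamma> (drop (length \<sigma>) v)"

inductive sem_tm :: "'n ctxt \<Rightarrow> ('n, 'k) tm \<Rightarrow> ('k env \<Rightarrow> 'k val) \<Rightarrow> bool" where
  sem_Attr: "n < length \<Gamma> \<Longrightarrow> i < length (\<Gamma> ! n) \<Longrightarrow> \<Gamma> ! n ! i = x \<Longrightarrow> count_list (\<Gamma> ! n) x = 1
    \<Longrightarrow> sem_tm \<Gamma> (Attr n x) (\<lambda>\<eta>. \<eta> ! n ! i)"
| sem_Const: "sem_tm \<Gamma> (Const k) (\<lambda>\<eta>. VConst k)"
| sem_NULL: "sem_tm \<Gamma> NULL (\<lambda>\<eta>. VNull)"

inductive sem_tms :: "'n ctxt \<Rightarrow> ('n, 'k) tm list \<Rightarrow> ('k env \<Rightarrow> 'k val list) \<Rightarrow> bool" where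
  sem_tms_Nil: "sem_tms \<Gamma> [] (\<lambda>\<eta>. [])"
| sem_tms_Cons: "sem_tm \<Gamma> t S \<Longrightarrow> sem_tms \<Gamma> ts Ss \<Longrightarrow> sem_tms \<Gamma> (t # ts) (\<lambda>\<eta>. S \<eta> # Ss \<eta>)"

text \<open>The select list that \<open>*\<close> abbreviates for a \<open>FROM\<close> list with context \<open>\<Gamma>'\<close>.\<close>

definition star_terms :: "'n ctxt \<Rightarrow> ('n, 'k) tm list" where
  "star_terms \<Gamma>' = concat (map (\<lambda>n. map (Attr n) (\<Gamma>' ! n)) [0..<length \<Gamma>'])"

definition sem_pred ::
  "('b, 'z) truth_structure_scheme \<Rightarrow> ('k list \<Rightarrow> bool) \<Rightarrow> 'k val list \<Rightarrow> 'b" where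
  "sem_pred B P vs =
     (if VNull \<in> set vs then bunknown B
      else of_bool_in B (P (map (\<lambda>v. case v of VConst k \<Rightarrow> k) vs)))"

definition sem_eq_tuple ::
  "('b, 'z) truth_structure_scheme \<Rightarrow> 'k val list \<Rightarrow> 'k val list \<Rightarrow> 'b" where
  "sem_eq_tuple B vs ws =
     foldr (\<lambda>(v, w). band B (sem_pred B (\<lambda>ks. ks ! 0 = ks ! 1) [v, w])) (zip vs ws) (btrue B)"

definition sem_in :: "('b, 'z) truth_structure_scheme \<Rightarrow> 'k val list \<Rightarrow> 'k rel \<Rightarrow> 'b" where
  "sem_in B v r =
     (if \<exists>w \<in># r. sem_eq_tuple B v w = btrue B then btrue B
      else if \<exists>w \<in># r. sem_eq_tuple B v w \<noteq> bfalse B then bunknown B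
      else bfalse B)"

text \<open>The rows of the \<open>FROM\<close> clause retained by the \<open>WHERE\<close> clause: those for which the
  condition is true, neither false nor unknown.\<close>

definition rel_where ::
  "('b, 'z) truth_structure_scheme \<Rightarrow> 'n ctxt \<Rightarrow> ('k env \<Rightarrow> 'k rel) \<Rightarrow> ('k env \<Rightarrow> 'b)
     \<Rightarrow> 'k env \<Rightarrow> 'k rel" where
  "rel_where B \<Gamma>' SF Sc \<eta> = {#v \<in># SF \<eta>. Sc (split_env \<Gamma>' v @ \<eta>) = btrue B#}"

definition rel_select ::
  "('b, 'z) truth_structure_scheme \<Rightarrow> 'n ctxt \<Rightarrow> ('k env \<Rightarrow> 'k rel) \<Rightarrow> ('k env \<Rightarrow> 'b)
     \<Rightarrow> ('k env \<Rightarrow> 'k val list) \<Rightarrow> 'k env \<Rightarrow> 'k rel" where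
  "rel_select B \<Gamma>' SF Sc St \<eta> =
     image_mset (\<lambda>v. St (split_env \<Gamma>' v @ \<eta>)) (rel_where B \<Gamma>' SF Sc \<eta>)"

text \<open>In \<open>sem_from B D \<Gamma> F \<Gamma>' S\<close> the context \<open>\<Gamma>'\<close> is the one declared by \<open>F\<close>.
  In the set operations the operands must have the same number of columns, and the names
  are those of the left operand. Directly below \<open>EXISTS\<close> the select list \<open>*\<close> is not evaluated,
  so that repeated names do no harm there.\<close>

inductive
  sem_cond :: "'b truth_structure \<Rightarrow> ('n, 'k) database \<Rightarrow> 'n ctxt \<Rightarrow> ('n, 'k) cond
    \<Rightarrow> ('k env \<Rightarrow> 'b) \<Rightarrow> bool"
and sem_query :: "'b truth_structure \<Rightarrow> ('n, 'k) database \<Rightarrow> 'n ctxt \<Rightarrow> ('n, 'k) query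
    \<Rightarrow> 'n schema \<Rightarrow> ('k env \<Rightarrow> 'k rel) \<Rightarrow> bool"
and sem_table :: "'b truth_structure \<Rightarrow> ('n, 'k) database \<Rightarrow> 'n ctxt \<Rightarrow> ('n, 'k) table
    \<Rightarrow> 'n schema \<Rightarrow> ('k env \<Rightarrow> 'k rel) \<Rightarrow> bool"
and sem_from :: "'b truth_structure \<Rightarrow> ('n, 'k) database \<Rightarrow> 'n ctxt \<Rightarrow> ('n, 'k) from_list
    \<Rightarrow> 'n ctxt \<Rightarrow> ('k env \<Rightarrow> 'k rel) \<Rightarrow> bool"
for B :: "'b truth_structure" and D :: "('n, 'k) database" where
  sem_True: "sem_cond B D \<Gamma> CTrue (\<lambda>\<eta>. btrue B)"
| sem_False: "sem_cond B D \<Gamma> CFalse (\<lambda>\<eta>. bfalse B)"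
| sem_IsNull: "sem_tm \<Gamma> t S
    \<Longrightarrow> sem_cond B D \<Gamma> (CIsNull t) (\<lambda>\<eta>. of_bool_in B (S \<eta> = VNull))"
| sem_Pred: "sem_tms \<Gamma> ts S \<Longrightarrow> sem_cond B D \<Gamma> (CPred P ts) (\<lambda>\<eta>. sem_pred B P (S \<eta>))"
| sem_In: "sem_tms \<Gamma> ts St \<Longrightarrow> sem_query B D \<Gamma> Q \<tau> SQ \<Longrightarrow> length ts = length \<tau>
    \<Longrightarrow> sem_cond B D \<Gamma> (CIn ts Q) (\<lambda>\<eta>. sem_in B (St \<eta>) (SQ \<eta>))"
| sem_Exists: "\<not> is_star Q \<Longrightarrow> sem_query B D \<Gamma> Q \<tau> SQ
    \<Longrightarrow> sem_cond B D \<Gamma> (CExists Q) (\<lambda>\<eta>. of_bool_in B (SQ \<eta> \<noteq> {#}))"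
| sem_Exists_star: "sem_from B D \<Gamma> F \<Gamma>' SF \<Longrightarrow> sem_cond B D (\<Gamma>' @ \<Gamma>) c Sc
    \<Longrightarrow> sem_cond B D \<Gamma> (CExists (SelectStar d F c))
          (\<lambda>\<eta>. of_bool_in B (rel_where B \<Gamma>' SF Sc \<eta> \<noteq> {#}))"
| sem_And: "sem_cond B D \<Gamma> c1 S1 \<Longrightarrow> sem_cond B D \<Gamma> c2 S2
    \<Longrightarrow> sem_cond B D \<Gamma> (CAnd c1 c2) (\<lambda>\<eta>. band B (S1 \<eta>) (S2 \<eta>))"
| sem_Or: "sem_cond B D \<Gamma> c1 S1 \<Longrightarrow> sem_cond B D \<Gamma> c2 S2
    \<Longrightarrow> sem_cond B D \<Gamma> (COr c1 c2) (\<lambda>\<eta>. bor B (S1 \<eta>) (S2 \<eta>))"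
| sem_Not: "sem_cond B D \<Gamma> c S \<Longrightarrow> sem_cond B D \<Gamma> (CNot c) (\<lambda>\<eta>. bneg B (S \<eta>))"

| sem_Select: "sem_from B D \<Gamma> F \<Gamma>' SF \<Longrightarrow> sem_cond B D (\<Gamma>' @ \<Gamma>) c Sc
    \<Longrightarrow> sem_tms (\<Gamma>' @ \<Gamma>) (map fst txs) St
    \<Longrightarrow> sem_query B D \<Gamma> (Select d txs F c) (map snd txs)
          (\<lambda>\<eta>. quantify d (rel_select B \<Gamma>' SF Sc St \<eta>))"
| sem_SelectStar: "sem_from B D \<Gamma> F \<Gamma>' SF \<Longrightarrow> sem_cond B D (\<Gamma>' @ \<Gamma>) c Sc
    \<Longrightarrow> sem_tms (\<Gamma>' @ \<Gamma>) (star_terms \<Gamma>') St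
    \<Longrightarrow> sem_query B D \<Gamma> (SelectStar d F c) (concat \<Gamma>')
          (\<lambda>\<eta>. quantify d (rel_select B \<Gamma>' SF Sc St \<eta>))"
| sem_Union: "sem_query B D \<Gamma> Q1 \<tau>1 S1 \<Longrightarrow> sem_query B D \<Gamma> Q2 \<tau>2 S2 \<Longrightarrow> length \<tau>1 = length \<tau>2
    \<Longrightarrow> sem_query B D \<Gamma> (QUnion d Q1 Q2) \<tau>1 (\<lambda>\<eta>. quantify d (S1 \<eta> + S2 \<eta>))"
| sem_Intersect: "sem_query B D \<Gamma> Q1 \<tau>1 S1 \<Longrightarrow> sem_query B D \<Gamma> Q2 \<tau>2 S2 \<Longrightarrow> length \<tau>1 = length \<tau>2
    \<Longrightarrow> sem_query B D \<Gamma> (QIntersect d Q1 Q2) \<tau>1 (\<lambda>\<eta>. quantify d (S1 \<eta> \<inter># S2 \<eta>))"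
| sem_Except: "sem_query B D \<Gamma> Q1 \<tau>1 S1 \<Longrightarrow> sem_query B D \<Gamma> Q2 \<tau>2 S2 \<Longrightarrow> length \<tau>1 = length \<tau>2
    \<Longrightarrow> sem_query B D \<Gamma> (QExcept d Q1 Q2) \<tau>1 (\<lambda>\<eta>. rel_except d (S1 \<eta>) (S2 \<eta>))"

| sem_Table: "db_schema D x = Some \<sigma> \<Longrightarrow> sem_table B D \<Gamma> (Table x) \<sigma> (\<lambda>\<eta>. db_rel D x)"
| sem_Query: "sem_query B D \<Gamma> Q \<tau> S \<Longrightarrow> sem_table B D \<Gamma> (Query Q) \<tau> S"

| sem_from_Nil: "sem_from B D \<Gamma> [] [] (\<lambda>\<eta>. {#[]#})"
| sem_from_Cons: "sem_table B D \<Gamma> T \<tau> S \<Longrightarrow> length \<tau> = length \<rho> \<Longrightarrow> sem_from B D \<Gamma> F \<Gamma>' SF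
    \<Longrightarrow> sem_from B D \<Gamma> ((T, \<rho>) # F) (\<rho> # \<Gamma>') (\<lambda>\<eta>. rel_times (S \<eta>) (SF \<eta>))"

end

theory Submission
  imports Defs
begin

text \<open>Evaluation is a partial function, so the derivations for \<open>T\<close> and \<open>c\<close> inside the two
  queries give the same \<open>FROM\<close> rows and the same filter. On a row \<open>v\<close> kept by the filter, the
  outer select list of the nested query reads its column \<open>0.x\<^sub>i\<close> from the tuple of
  values of \<open>u\<^sub>1, \<dots>, u\<^sub>k\<close> at \<open>v\<close>, which is what the substituted term computes from \<open>v\<close>
  directly; terms with a positive index see the same part of the environment in both queries.\<close>

text \<open>The rule \<open>sem_Attr\<close> leaves the position \<open>i\<close> of a name free;
  that the name occurs only once pins it down and so makes the evaluation of an attribute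
  single-valued.\<close>

lemma count_list_nth_unique:
  assumes "count_list xs x = 1" "i < length xs" "j < length xs" "xs ! i = x" "xs ! j = x"
  shows "i = j"
  using assms
proof (induction xs arbitrary: i j)
  case (Cons a xs)
  \<comment> \<open>If the head is the name, its only occurrence is spent, so both indices must be
    0.\<close>
  have "x \<notin> set xs" if "a = x"
    using that Cons.prems(1) by (simp add: count_list_0_iff)
  then show ?case
    using Cons by (cases i; cases j) (auto split: if_splits)
qed simp

text \<open>\<open>subst_tm\<close> finds a column by name through \<open>map_of\<close>, the
  semantics by position. A hit of \<open>map_of\<close> comes from some position carrying the same
  name, and a single occurrence leaves only \<open>i\<close>.\<close>

lemma map_of_zip_nth_count_list:
  assumes "length xs = length ys" "i < length xs" "count_list xs (xs ! i) = 1"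
  shows "map_of (zip xs ys) (xs ! i) = Some (ys ! i)"
proof -
  have "xs ! i \<in> set xs"
    using assms(2) by simp
  then obtain y where y: "map_of (zip xs ys) (xs ! i) = Some y"
    using map_of_zip_is_Some[OF assms(1)] by blast
  then obtain j where "j < length xs" "xs ! j = xs ! i" "ys ! j = y"
    using assms(1) by (fastforce dest!: map_of_SomeD simp: in_set_conv_nth)
  with count_list_nth_unique[OF assms(3) _ assms(2)] y show ?thesis
    by auto
qed

lemma sem_tm_deterministic:
  assumes "sem_tm \<Gamma> t S" "sem_tm \<Gamma> t S'"
  shows "S' = S"
  using assms by (cases t) (auto elim!: sem_tm.cases dest: count_list_nth_unique)

lemma sem_tms_deterministic:
  assumes "sem_tms \<Gamma> ts S" "sem_tms \<Gamma> ts S'"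
  shows "S' = S"
  using assms
proof (induction arbitrary: S' rule: sem_tms.induct)
  case sem_tms_Nil
  then show ?case by (auto elim: sem_tms.cases)
next
  case (sem_tms_Cons \<Gamma> t S ts Ss)
  from sem_tms_Cons.prems obtain R Rs
    where "S' = (\<lambda>\<eta>. R \<eta> # Rs \<eta>)" "sem_tm \<Gamma> t R" "sem_tms \<Gamma> ts Rs"
    by (auto elim: sem_tms.cases)
  with sem_tms_Cons show ?case
    using sem_tm_deterministic by blast
qed

lemma sem_tms_nth:
  assumes "sem_tms \<Gamma> ts S"
  shows "length (S \<eta>) = length ts"
    and "i < length ts \<Longrightarrow> sem_tm \<Gamma> (ts ! i) (\<lambda>\<eta>. S \<eta> ! i)"
  using assms
proof (induction arbitrary: i rule: sem_tms.induct)
  case (sem_tms_Cons \<Gamma> t S ts Ss)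
  {
    case 1
    then show ?case using sem_tms_Cons by simp
  next
    case 2
    then show ?case using sem_tms_Cons by (cases i) simp_all
  }
qed simp_all

inductive_cases sem_cond_TrueE: "sem_cond B D \<Gamma> CTrue S"
inductive_cases sem_cond_FalseE: "sem_cond B D \<Gamma> CFalse S"
inductive_cases sem_cond_IsNullE: "sem_cond B D \<Gamma> (CIsNull t) S"
inductive_cases sem_cond_PredE: "sem_cond B D \<Gamma> (CPred P ts) S"
inductive_cases sem_cond_InE: "sem_cond B D \<Gamma> (CIn ts Q) S"
inductive_cases sem_cond_ExistsE: "sem_cond B D \<Gamma> (CExists Q) S"
inductive_cases sem_cond_AndE: "sem_cond B D \<Gamma> (CAnd c1 c2) S"
inductive_cases sem_cond_OrE: "sem_cond B D \<Gamma> (COr c1 c2) S"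
inductive_cases sem_cond_NotE: "sem_cond B D \<Gamma> (CNot c) S"
inductive_cases sem_query_SelectE: "sem_query B D \<Gamma> (Select d txs F c) \<tau> S"
inductive_cases sem_query_SelectStarE: "sem_query B D \<Gamma> (SelectStar d F c) \<tau> S"
inductive_cases sem_query_UnionE: "sem_query B D \<Gamma> (QUnion d Q1 Q2) \<tau> S"
inductive_cases sem_query_IntersectE: "sem_query B D \<Gamma> (QIntersect d Q1 Q2) \<tau> S"
inductive_cases sem_query_ExceptE: "sem_query B D \<Gamma> (QExcept d Q1 Q2) \<tau> S"
inductive_cases sem_table_TableE: "sem_table B D \<Gamma> (Table x) \<tau> S"
inductive_cases sem_table_QueryE: "sem_table B D \<Gamma> (Query Q) \<tau> S"
inductive_cases sem_from_NilE: "sem_from B D \<Gamma> [] \<Gamma>' S"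
inductive_cases sem_from_ConsE: "sem_from B D \<Gamma> ((T, \<rho>) # F) \<Gamma>' S"

text \<open>Schemas and contexts must be shown unique along with the evaluations: \<open>c\<close>
  is evaluated in \<open>\<Gamma>' @ \<Gamma>\<close>, so two derivations can be compared on
  \<open>c\<close> only once their \<open>FROM\<close> lists are known to declare the same
  \<open>\<Gamma>'\<close>.\<close>

lemma sem_deterministic:
  shows sem_cond_deterministic:
      "sem_cond B D \<Gamma> c Sc \<Longrightarrow> sem_cond B D \<Gamma> c Sc' \<Longrightarrow> Sc' = Sc"
    and sem_query_deterministic:
      "sem_query B D \<Gamma> Q \<tau> SQ \<Longrightarrow> sem_query B D \<Gamma> Q \<tau>' SQ' \<Longrightarrow> \<tau>' = \<tau> \<and> SQ' = SQ"
    and sem_table_deterministic: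
      "sem_table B D \<Gamma> T \<tau> ST \<Longrightarrow> sem_table B D \<Gamma> T \<tau>' ST' \<Longrightarrow> \<tau>' = \<tau> \<and> ST' = ST"
    and sem_from_deterministic:
      "sem_from B D \<Gamma> F \<Gamma>' SF \<Longrightarrow> sem_from B D \<Gamma> F \<Gamma>'' SF' \<Longrightarrow> \<Gamma>'' = \<Gamma>' \<and> SF' = SF"
proof (induction arbitrary: Sc' and \<tau>' SQ' and \<tau>' ST' and \<Gamma>'' SF'
    rule: sem_cond_sem_query_sem_table_sem_from.inducts)
  case sem_True
  then show ?case by (rule sem_cond_TrueE)
next
  case sem_False
  then show ?case by (rule sem_cond_FalseE)
next
  case sem_IsNull
  from sem_IsNull(2) show ?case
    by (rule sem_cond_IsNullE) (auto dest: sem_tm_deterministic[OF sem_IsNull(1)])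
next
  case sem_Pred
  from sem_Pred(2) show ?case
    by (rule sem_cond_PredE) (auto dest: sem_tms_deterministic[OF sem_Pred(1)])
next
  case sem_In
  from sem_In.prems show ?case
    by (rule sem_cond_InE) (auto dest: sem_In.IH(2) sem_tms_deterministic[OF sem_In.hyps(1)])
next
  case sem_Exists
  \<comment> \<open>Two rules conclude a \<open>CExists\<close> judgement; \<open>is_star\<close>
    separates them, so inversion leaves only the rule already used, here and in the next
    case.\<close>
  from sem_Exists.prems show ?case
    by (rule sem_cond_ExistsE) (use sem_Exists.hyps(1) in \<open>auto dest: sem_Exists.IH(2)\<close>)
next
  case sem_Exists_star
  from sem_Exists_star.prems show ?case
    by (rule sem_cond_ExistsE) (auto dest: sem_Exists_star.IH(2,4))
next
  case sem_And
  from sem_And.prems show ?case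
    by (rule sem_cond_AndE) (auto dest: sem_And.IH(2,4))
next
  case sem_Or
  from sem_Or.prems show ?case
    by (rule sem_cond_OrE) (auto dest: sem_Or.IH(2,4))
next
  case sem_Not
  from sem_Not.prems show ?case
    by (rule sem_cond_NotE) (auto dest: sem_Not.IH(2))
next
  case sem_Select
  from sem_Select.prems show ?case
    by (rule sem_query_SelectE) (auto dest: sem_Select.IH(2,4) sem_tms_deterministic[OF sem_Select.hyps(1)])
next
  case sem_SelectStar
  from sem_SelectStar.prems show ?case
    by (rule sem_query_SelectStarE) (auto dest: sem_SelectStar.IH(2,4) sem_tms_deterministic[OF sem_SelectStar.hyps(1)])
next
  case sem_Union
  from sem_Union.prems show ?case
    by (rule sem_query_UnionE) (auto dest: sem_Union.IH(2,4))
next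
  case sem_Intersect
  from sem_Intersect.prems show ?case
    by (rule sem_query_IntersectE) (auto dest: sem_Intersect.IH(2,4))
next
  case sem_Except
  from sem_Except.prems show ?case
    by (rule sem_query_ExceptE) (auto dest: sem_Except.IH(2,4))
next
  case sem_Table
  from sem_Table.prems show ?case
    by (rule sem_table_TableE) (use sem_Table in auto)
next
  case sem_Query
  from sem_Query.prems show ?case
    by (rule sem_table_QueryE) (auto dest: sem_Query.IH(2))
next
  case sem_from_Nil
  then show ?case by (rule sem_from_NilE) blast
next
  case sem_from_Cons
  from sem_from_Cons.prems show ?case
    by (rule sem_from_ConsE) (auto dest: sem_from_Cons.IH(2,4))
qed

text \<open>The product over a \<open>FROM\<close> list ends in the relation holding only the empty
  tuple; this removes it for a one-table list.\<close>

lemma rel_times_unit [simp]: "rel_times r {#[]#} = r"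
  by (induction r) (simp_all add: rel_times_def)

lemma sem_from_singletonE:
  assumes "sem_from B D \<Gamma> [(T, \<rho>)] \<Gamma>' SF"
  obtains \<tau> where "sem_table B D \<Gamma> T \<tau> SF" "length \<tau> = length \<rho>" "\<Gamma>' = [\<rho>]"
  using assms by (elim sem_from_ConsE sem_from_NilE) simp

text \<open>\<open>Su (w # \<eta>)\<close> is the row that the inner query produces from
  \<open>w\<close>: it heads the environment of the outer select list, where \<open>w\<close> heads
  that of the substituted one. For an attribute, an explicit evaluation of the substituted term is
  found and determinism identifies it with \<open>S'\<close>.\<close>

lemma sem_tm_subst_tm:
  assumes t: "sem_tm (\<sigma>1 # \<Gamma>) t S"
    and t': "sem_tm (\<sigma>2 # \<Gamma>) (subst_tm \<sigma>1 us t) S'"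
    and us: "sem_tms (\<sigma>2 # \<Gamma>) us Su"
    and len: "length \<sigma>1 = length us"
  shows "S (Su (w # \<eta>) # \<eta>) = S' (w # \<eta>)"
  using t
proof cases
  case (sem_Attr n i x)
  show ?thesis
  proof (cases n)
    case 0
    \<comment> \<open>An attribute has an evaluation only if its name occurs once in
      \<open>\<sigma>1\<close>, so the look-up by name in \<open>zip \<sigma>1 us\<close> returns
      the entry at position \<open>i\<close>.\<close>
    with sem_Attr len have "subst_tm \<sigma>1 us t = us ! i"
      using map_of_zip_nth_count_list[of \<sigma>1 us i] by auto
    moreover have "sem_tm (\<sigma>2 # \<Gamma>) (us ! i) (\<lambda>\<eta>. Su \<eta> ! i)"
      using sem_tms_nth(2)[OF us] sem_Attr 0 len by simp
    ultimately have "S' = (\<lambda>\<eta>. Su \<eta> ! i)"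
      using t' sem_tm_deterministic by metis
    with sem_Attr 0 show ?thesis by simp
  next
    case (Suc m)
    \<comment> \<open>Replacing the head schema does not affect this term: an index
      \<open>Suc m\<close> looks past the head of the context and of the environment.\<close>
    with sem_Attr have "sem_tm (\<sigma>2 # \<Gamma>) (subst_tm \<sigma>1 us t) (\<lambda>\<eta>. \<eta> ! n ! i)"
      using sem_tm.sem_Attr[of n "\<sigma>2 # \<Gamma>" i x] by simp
    with t' have "S' = (\<lambda>\<eta>. \<eta> ! n ! i)"
      by (rule sem_tm_deterministic[rotated])
    with sem_Attr Suc show ?thesis by simp
  qed
next
  case (sem_Const k)
  with t' show ?thesis by (auto elim: sem_tm.cases)
next
  case sem_NULL
  with t' show ?thesis by (auto elim: sem_tm.cases)
qed

lemma sem_tms_subst_tm: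
  assumes ts: "sem_tms (\<sigma>1 # \<Gamma>) ts S"
    and ts': "sem_tms (\<sigma>2 # \<Gamma>) (map (subst_tm \<sigma>1 us) ts) S'"
    and us: "sem_tms (\<sigma>2 # \<Gamma>) us Su"
    and len: "length \<sigma>1 = length us"
  shows "S (Su (w # \<eta>) # \<eta>) = S' (w # \<eta>)"
proof (rule nth_equalityI)
  show "length (S (Su (w # \<eta>) # \<eta>)) = length (S' (w # \<eta>))"
    using sem_tms_nth(1)[OF ts] sem_tms_nth(1)[OF ts'] by simp
next
  fix i assume "i < length (S (Su (w # \<eta>) # \<eta>))"
  then have i: "i < length ts"
    using sem_tms_nth(1)[OF ts] by simp
  have "sem_tm (\<sigma>2 # \<Gamma>) (subst_tm \<sigma>1 us (ts ! i)) (\<lambda>\<eta>. S' \<eta> ! i)"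
    using sem_tms_nth(2)[OF ts', of i] i by simp
  from sem_tm_subst_tm[OF sem_tms_nth(2)[OF ts i] this us len]
  show "S (Su (w # \<eta>) # \<eta>) ! i = S' (w # \<eta>) ! i" .
qed

text \<open>The outer, the inner and the substituted query all have this shape, so one inversion
  rule serves all three.\<close>

lemma sem_query_Select_singletonE:
  assumes "sem_query B D \<Gamma> (Select QAll txs [(T, \<rho>)] c) \<tau> S"
  obtains \<tau>T ST Sc St where "sem_table B D \<Gamma> T \<tau>T ST" "length \<tau>T = length \<rho>"
    "sem_cond B D (\<rho> # \<Gamma>) c Sc" "sem_tms (\<rho> # \<Gamma>) (map fst txs) St"
    "\<tau> = map snd txs" "S = rel_select B [\<rho>] ST Sc St"
  using assms by (elim sem_query_SelectE sem_from_singletonE) (simp add: quantify_def)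

theorem theorem2:
  fixes B :: "'b truth_structure" and D :: "('n, 'k) database"
    and \<Gamma> :: "'n ctxt" and T :: "('n, 'k) table" and c :: "('n, 'k) cond"
    and \<sigma>1 \<sigma>2 \<tau> \<tau>' :: "'n schema" and tx uy :: "('n, 'k) select_list"
    and S S' :: "'k env \<Rightarrow> 'k rel"
  assumes "kleene_logic B \<or> boolean_logic B"
    and "wf_database D"
    and "sem_query B D \<Gamma> (Select QAll tx [(Query (Select QAll uy [(T, \<sigma>2)] c), \<sigma>1)] CTrue) \<tau> S"
    and "sem_query B D \<Gamma> (Select QAll (subst_select tx \<sigma>1 (map fst uy)) [(T, \<sigma>2)] c) \<tau>' S'"
  shows "\<forall>\<eta>. env_for \<Gamma> \<eta> \<longrightarrow> S \<eta> = S' \<eta>"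
proof -
  let ?us = "map fst uy"
  obtain SQ Strue St \<tau>Q where
    "sem_table B D \<Gamma> (Query (Select QAll uy [(T, \<sigma>2)] c)) \<tau>Q SQ" and
    len: "length \<tau>Q = length \<sigma>1" and
    "sem_cond B D (\<sigma>1 # \<Gamma>) CTrue Strue" and
    St: "sem_tms (\<sigma>1 # \<Gamma>) (map fst tx) St" and
    S: "S = rel_select B [\<sigma>1] SQ Strue St"
    using assms(3) by (rule sem_query_Select_singletonE)
  \<comment> \<open>\<open>TRUE\<close> evaluates to the constant \<open>btrue B\<close>, so the
    outer filter will keep every row.\<close>
  then have Q: "sem_query B D \<Gamma> (Select QAll uy [(T, \<sigma>2)] c) \<tau>Q SQ"
    and Strue: "Strue = (\<lambda>\<eta>. btrue B)"
    by (auto elim: sem_table_QueryE sem_cond_TrueE)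
  obtain ST Sc Su \<tau>T where
    T: "sem_table B D \<Gamma> T \<tau>T ST" and
    c: "sem_cond B D (\<sigma>2 # \<Gamma>) c Sc" and
    Su: "sem_tms (\<sigma>2 # \<Gamma>) ?us Su" and
    "\<tau>Q = map snd uy" and
    SQ: "SQ = rel_select B [\<sigma>2] ST Sc Su"
    using Q by (rule sem_query_Select_singletonE)
  \<comment> \<open>The outer \<open>FROM\<close> list gives \<open>\<sigma>1\<close> the length of
    the inner query's schema, which has one name per term of \<open>uy\<close>.\<close>
  with len have len_us: "length \<sigma>1 = length ?us" by simp
  obtain ST' Sc' St' \<tau>T' where
    T': "sem_table B D \<Gamma> T \<tau>T' ST'" and
    c': "sem_cond B D (\<sigma>2 # \<Gamma>) c Sc'" and
    "sem_tms (\<sigma>2 # \<Gamma>) (map fst (subst_select tx \<sigma>1 ?us)) St'" and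
    S': "S' = rel_select B [\<sigma>2] ST' Sc' St'"
    using assms(4) by (rule sem_query_Select_singletonE)
  then have St': "sem_tms (\<sigma>2 # \<Gamma>) (map (subst_tm \<sigma>1 ?us) (map fst tx)) St'"
    by (simp add: subst_select_def split_def comp_def)
  have "ST' = ST" "Sc' = Sc"
    using sem_table_deterministic[OF T T'] sem_cond_deterministic[OF c c'] by simp_all
  \<comment> \<open>The two nested images compose into one. Here \<open>w\<close> is the sole entry
    of \<open>split_env [\<sigma>2] v\<close>, and splitting along \<open>[\<sigma>1]\<close> keeps
    the whole tuple of values of \<open>?us\<close>, since its length is that of
    \<open>\<sigma>1\<close>.\<close>
  then show ?thesis
    using sem_tms_subst_tm[OF St St' Su len_us] sem_tms_nth(1)[OF Su] len_us
    by (simp add: S SQ S' Strue rel_select_def rel_where_def multiset.map_comp comp_def)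
qed

end
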